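(* Let $r \in \mathbb{N}$ with $r \geq 2$, and let $n = 3r^2-2$. Then there exists an $n$-vertex interval graph with twin-width at least $\left(\tfrac{n+2}{12}\right)^{1/4}-1$.
   Context: All graphs are finite, simple and undirected. For a finite family $\mathcal{I}$ of closed intervals on the real line, the corresponding interval graph $G_{\mathcal{I}}$ is the graph with vertex-set $\mathcal{I}$ in which two distinct vertices are adjacent if and only if the corresponding intervals have non-empty intersection; an interval graph is a graph (isomorphic to one) of this form. Twin-width: a trigraph is a graph together with a partition of its edge-set into black edges and red edges; an ordinary graph is regarded as a trigraph with all edges black. Contracting two distinct (not necessarily adjacent) vertices $u,v$ of a trigraph means replacing them by a single new vertex $w$ such that, for every other vertex $x$: $wx$ is a black edge if both $ux$ and $vx$ are black edges; $wx$ is a non-edge if neither $ux$ nor $vx$ is an edge; and $wx$ is a red edge otherwise. All other edges and their colours are unchanged. The red degree of a vertex is the number of red edges incident with it. A contraction sequence of an $n$-vertex graph $G$ is a sequence of trigraphs $G = G_n, \dots, G_1 = K_1$ where each $G_s$ is obtained from $G_{s+1}$ by one contraction; it is a $d$-sequence if every trigraph in it has maximum red degree at most $d$. The twin-width $\operatorname{tww}(G)$ is the minimum integer $d$ such that $G$ has a $d$-sequence. *)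

theory Defs
  imports Complex_Main "Graph_Theory.Pair_Digraph"
begin

text \<open>Finite simple undirected graphs are the graphs of the locale \<^locale>\<open>pair_graph\<close>: an edge
  between \<open>x\<close> and \<open>y\<close> is represented by the two arcs \<open>(x, y)\<close> and \<open>(y, x)\<close>. The same convention is used for the
  black and for the red edges of a trigraph.\<close>

definition intersection_graph :: "'i set \<Rightarrow> ('i \<Rightarrow> real set) \<Rightarrow> 'i pair_pre_digraph" where
  "intersection_graph A J =
    \<lparr>pverts = A, parcs = {(i, j). i \<in> A \<and> j \<in> A \<and> i \<noteq> j \<and> J i \<inter> J j \<noteq> {}}\<rparr>"

text \<open>A family of intervals may repeat an interval, so it is a function on an index set. Taking the
  vertices of the graph themselves as indices makes the notion closed under isomorphism.\<close>

definition interval_graph :: "'a pair_pre_digraph \<Rightarrow> bool" where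
  "interval_graph G \<longleftrightarrow> finite (pverts G) \<and>
    (\<exists>J. (\<forall>x\<in>pverts G. \<exists>a b. a \<le> b \<and> J x = {a..b}) \<and> G = intersection_graph (pverts G) J)"

lemma interval_graph_imp_pair_graph: "interval_graph G \<Longrightarrow> pair_graph G"
proof -
  assume "interval_graph G"
  then obtain J where fin: "finite (pverts G)" and G: "G = intersection_graph (pverts G) J"
    unfolding interval_graph_def by blast
  have arcs: "parcs G = {(i, j). i \<in> pverts G \<and> j \<in> pverts G \<and> i \<noteq> j \<and> J i \<inter> J j \<noteq> {}}"
    by (subst G) (simp add: intersection_graph_def)
  have "parcs G \<subseteq> pverts G \<times> pverts G"
    using arcs by auto
  then have "finite (parcs G)"
    by (rule finite_subset) (simp add: fin)
  moreover have "sym (parcs G)" "irrefl (parcs G)"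
    using arcs by (auto simp: sym_def irrefl_def)
  ultimately show ?thesis
    using fin \<open>parcs G \<subseteq> pverts G \<times> pverts G\<close>
    by unfold_locales (auto simp: symmetric_def irrefl_def)
qed

record 'a trigraph =
  tverts :: "'a set"
  black :: "'a rel"
  red :: "'a rel"

definition wf_trigraph :: "'a trigraph \<Rightarrow> bool" where
  "wf_trigraph T \<longleftrightarrow> pair_graph \<lparr>pverts = tverts T, parcs = black T \<union> red T\<rparr> \<and>
    black T \<inter> red T = {} \<and> sym (black T) \<and> sym (red T)"

definition trigraph_of :: "'a pair_pre_digraph \<Rightarrow> 'a trigraph" where
  "trigraph_of G = \<lparr>tverts = pverts G, black = parcs G, red = {}\<rparr>"

definition contract :: "'a \<Rightarrow> 'a \<Rightarrow> 'a \<Rightarrow> 'a trigraph \<Rightarrow> 'a trigraph" where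
  "contract u v w T =
    (let X = tverts T - {u, v};
         B = {x \<in> X. (u, x) \<in> black T \<and> (v, x) \<in> black T};
         N = {x \<in> X. (u, x) \<notin> black T \<union> red T \<and> (v, x) \<notin> black T \<union> red T};
         R = X - B - N
     in \<lparr>tverts = insert w X,
         black = (black T \<inter> X \<times> X) \<union> {w} \<times> B \<union> B \<times> {w},
         red = (red T \<inter> X \<times> X) \<union> {w} \<times> R \<union> R \<times> {w}\<rparr>)"

text \<open>The name \<open>w\<close> of the new vertex only has to differ from the names of the remaining vertices; it
  may be \<open>u\<close> or \<open>v\<close>, so that a contraction is possible in every vertex type.\<close>

definition contraction :: "'a trigraph \<Rightarrow> 'a trigraph \<Rightarrow> bool" where
  "contraction T T' \<longleftrightarrow> (\<exists>u v w. u \<in> tverts T \<and> v \<in> tverts T \<and> u \<noteq> v \<and>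
    w \<notin> tverts T - {u, v} \<and> T' = contract u v w T)"

definition red_degree :: "'a trigraph \<Rightarrow> 'a \<Rightarrow> nat" where
  "red_degree T x = card {y. (x, y) \<in> red T}"

lemma wf_trigraph_iff:
  "wf_trigraph T \<longleftrightarrow> finite (tverts T) \<and> black T \<union> red T \<subseteq> tverts T \<times> tverts T \<and>
    irrefl (black T \<union> red T) \<and> black T \<inter> red T = {} \<and> sym (black T) \<and> sym (red T)"
proof
  assume wf: "wf_trigraph T"
  then interpret pair_graph "\<lparr>pverts = tverts T, parcs = black T \<union> red T\<rparr>"
    by (simp add: wf_trigraph_def)
  have "finite (tverts T)"
    using pair_finite_verts by simp
  moreover have "black T \<union> red T \<subseteq> tverts T \<times> tverts T"
  proof
    fix e assume "e \<in> black T \<union> red T"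
    then show "e \<in> tverts T \<times> tverts T"
      using arc_fst_in_verts[of e] arc_snd_in_verts[of e] by (cases e) auto
  qed
  moreover have "irrefl (black T \<union> red T)"
    unfolding irrefl_def
  proof (intro allI notI)
    fix x assume "(x, x) \<in> black T \<union> red T"
    then show False
      using pair_no_loops[of "(x, x)"] by simp
  qed
  ultimately show "finite (tverts T) \<and> black T \<union> red T \<subseteq> tverts T \<times> tverts T \<and>
    irrefl (black T \<union> red T) \<and> black T \<inter> red T = {} \<and> sym (black T) \<and> sym (red T)"
    using wf by (simp add: wf_trigraph_def)
next
  assume *: "finite (tverts T) \<and> black T \<union> red T \<subseteq> tverts T \<times> tverts T \<and>
    irrefl (black T \<union> red T) \<and> black T \<inter> red T = {} \<and> sym (black T) \<and> sym (red T)"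
  then have "finite (black T \<union> red T)"
    using finite_subset[of "black T \<union> red T" "tverts T \<times> tverts T"] by blast
  with * have "pair_graph \<lparr>pverts = tverts T, parcs = black T \<union> red T\<rparr>"
    by unfold_locales (auto simp: symmetric_def sym_def irrefl_def)
  with * show "wf_trigraph T"
    by (simp add: wf_trigraph_def)
qed

lemma wf_trigraph_of:
  assumes "pair_graph G"
  shows "wf_trigraph (trigraph_of G)"
proof -
  interpret pair_graph G by fact
  have "sym (parcs G)"
    using pair_sym_arcs by (simp add: symmetric_def)
  with assms show ?thesis
    unfolding wf_trigraph_def trigraph_of_def
    by (simp only: trigraph.simps pair_pre_digraph.surjective[symmetric] Un_empty_right
      Int_empty_right) (cases G, simp add: sym_def)
qed

lemma wf_contraction:
  assumes "wf_trigraph T" "contraction T T'"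
  shows "wf_trigraph T'" and "Suc (card (tverts T')) = card (tverts T)"
proof -
  obtain u v w where uvw: "u \<in> tverts T" "v \<in> tverts T" "u \<noteq> v" "w \<notin> tverts T - {u, v}"
    and T': "T' = contract u v w T"
    using assms(2) unfolding contraction_def by blast
  have fin: "finite (tverts T)"
    using assms(1) by (simp add: wf_trigraph_iff)
  show "Suc (card (tverts T')) = card (tverts T)"
  proof -
    have "card {u, v} \<le> card (tverts T)"
      using uvw fin by (intro card_mono) auto
    then have "card (tverts T) = Suc (Suc (card (tverts T - {u, v})))"
      using uvw fin by (simp add: card_Diff_subset)
    moreover have "card (tverts T') = Suc (card (tverts T - {u, v}))"
      using uvw fin by (simp add: T' contract_def Let_def)
    ultimately show ?thesis by simp
  qed
  have T: "black T \<union> red T \<subseteq> tverts T \<times> tverts T" "irrefl (black T \<union> red T)"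
    "black T \<inter> red T = {}" "sym (black T)" "sym (red T)"
    using assms(1) by (simp_all add: wf_trigraph_iff)
  define X where "X = tverts T - {u, v}"
  define B where "B = {x \<in> X. (u, x) \<in> black T \<and> (v, x) \<in> black T}"
  define R where "R = X - B - {x \<in> X. (u, x) \<notin> black T \<union> red T \<and> (v, x) \<notin> black T \<union> red T}"
  have T'_eq: "T' = \<lparr>tverts = insert w X, black = (black T \<inter> X \<times> X) \<union> {w} \<times> B \<union> B \<times> {w},
      red = (red T \<inter> X \<times> X) \<union> {w} \<times> R \<union> R \<times> {w}\<rparr>"
    unfolding T' contract_def Let_def R_def B_def X_def ..
  have BR: "B \<subseteq> X" "R \<subseteq> X" "B \<inter> R = {}" "w \<notin> X" "finite X"
    using uvw(4) fin by (auto simp: B_def R_def X_def)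
  have "irrefl (black T' \<union> red T')"
    using T(2) BR unfolding T'_eq irrefl_def by auto
  moreover have "black T' \<inter> red T' = {}"
    using T(3) BR unfolding T'_eq by auto
  moreover have "sym (black T')" "sym (red T')"
    using T(4,5) unfolding T'_eq sym_def by auto
  moreover have "black T' \<union> red T' \<subseteq> tverts T' \<times> tverts T'" "finite (tverts T')"
    using BR unfolding T'_eq by auto
  ultimately show "wf_trigraph T'"
    by (simp add: wf_trigraph_iff)
qed

text \<open>\<open>H s\<close> is the trigraph with \<open>s\<close> vertices; values of \<open>H\<close> outside \<open>{1..card (pverts G)}\<close> are
  irrelevant for a graph with at least one vertex.\<close>

definition contraction_sequence :: "'a pair_pre_digraph \<Rightarrow> (nat \<Rightarrow> 'a trigraph) \<Rightarrow> bool" where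
  "contraction_sequence G H \<longleftrightarrow>
    H (card (pverts G)) = trigraph_of G \<and>
    (\<forall>s. 1 \<le> s \<and> s < card (pverts G) \<longrightarrow> contraction (H (Suc s)) (H s)) \<and>
    (\<exists>x. H 1 = \<lparr>tverts = {x}, black = {}, red = {}\<rparr>)"

definition d_sequence :: "nat \<Rightarrow> 'a pair_pre_digraph \<Rightarrow> (nat \<Rightarrow> 'a trigraph) \<Rightarrow> bool" where
  "d_sequence d G H \<longleftrightarrow> contraction_sequence G H \<and>
    (\<forall>s. 1 \<le> s \<and> s \<le> card (pverts G) \<longrightarrow> (\<forall>x\<in>tverts (H s). red_degree (H s) x \<le> d))"

definition tww :: "'a pair_pre_digraph \<Rightarrow> nat" where
  "tww G = (LEAST d. \<exists>H. d_sequence d G H)"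

text \<open>The minimum is attained for every graph with at least one vertex.\<close>

lemma ex_contractions:
  assumes "wf_trigraph T" "card (tverts T) = Suc k"
  shows "\<exists>H. H (Suc k) = T \<and>
    (\<forall>s. 1 \<le> s \<and> s < Suc k \<longrightarrow> contraction (H (Suc s)) (H s)) \<and>
    (\<exists>x. H 1 = \<lparr>tverts = {x}, black = {}, red = {}\<rparr>)"
  using assms
proof (induction k arbitrary: T)
  case 0
  then obtain x where x: "tverts T = {x}"
    by (auto simp: card_Suc_eq)
  with 0 have "black T = {}" "red T = {}"
    by (auto simp: wf_trigraph_iff irrefl_def)
  with x have "T = \<lparr>tverts = {x}, black = {}, red = {}\<rparr>"
    by simp
  then show ?case
    by (intro exI[of _ "\<lambda>_. T"]) auto
next
  case (Suc k)
  obtain u v where "u \<in> tverts T" "v \<in> tverts T" "u \<noteq> v"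
    using Suc.prems(2) by (auto simp: card_Suc_eq)
  then have c: "contraction T (contract u v u T)"
    unfolding contraction_def by blast
  obtain H where H: "H (Suc k) = contract u v u T"
    "\<forall>s. 1 \<le> s \<and> s < Suc k \<longrightarrow> contraction (H (Suc s)) (H s)"
    "\<exists>x. H 1 = \<lparr>tverts = {x}, black = {}, red = {}\<rparr>"
    using Suc.IH[OF wf_contraction(1)[OF Suc.prems(1) c]] wf_contraction(2)[OF Suc.prems(1) c]
      Suc.prems(2) by auto
  let ?H = "H(Suc (Suc k) := T)"
  have "contraction (?H (Suc s)) (?H s)" if "1 \<le> s" "s < Suc (Suc k)" for s
    using that H(1,2) c by (cases "s = Suc k") auto
  with H(3) show ?case
    by (intro exI[of _ ?H]) auto
qed

lemma tww_attained:
  assumes "pair_graph G" "pverts G \<noteq> {}"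
  shows "\<exists>H. d_sequence (tww G) G H"
proof -
  interpret pair_graph G by fact
  obtain k where k: "card (pverts G) = Suc k"
    using assms(2) pair_finite_verts by (metis card_eq_0_iff not0_implies_Suc)
  then obtain H where H: "contraction_sequence G H"
    using ex_contractions[OF wf_trigraph_of[OF assms(1)], of k]
    unfolding contraction_sequence_def by (auto simp: trigraph_of_def)
  let ?n = "card (pverts G)"
  have wf: "wf_trigraph (H (?n - j))" if "j < ?n" for j
    using that
  proof (induction j)
    case 0
    then show ?case
      using H wf_trigraph_of[OF assms(1)] by (simp add: contraction_sequence_def)
  next
    case (Suc j)
    then have "contraction (H (Suc (?n - Suc j))) (H (?n - Suc j))"
      using H unfolding contraction_sequence_def by auto
    then show ?case
      using Suc wf_contraction(1) by (metis Suc_diff_Suc Suc_lessD)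
  qed
  define D where "D = (\<Union>s\<in>{1..?n}. red_degree (H s) ` tverts (H s))"
  have "finite (tverts (H s))" if "1 \<le> s" "s \<le> ?n" for s
  proof -
    have "?n - s < ?n" "?n - (?n - s) = s"
      using that by linarith+
    then show ?thesis
      using wf[of "?n - s"] unfolding wf_trigraph_iff by metis
  qed
  then have "finite D"
    unfolding D_def by auto
  then have "red_degree (H s) x \<le> Max D" if "1 \<le> s" "s \<le> ?n" "x \<in> tverts (H s)" for s x
    using that by (intro Max_ge) (auto simp: D_def)
  with H have "d_sequence (Max D) G H"
    unfolding d_sequence_def by blast
  then show ?thesis
    unfolding tww_def by (blast intro: LeastI_ex[of "\<lambda>d. \<exists>H. d_sequence d G H"])
qed

end

theory Submission
  imports Defs
begin

text \<open>Take \<open>r\<^sup>2\<close> pairwise intersecting intervals whose left endpoints are ordered like the cells of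
  an \<open>r \<times> r\<close> grid read row by row and whose right endpoints are ordered like the cells read column
  by column, and put one point interval into every gap between consecutive left endpoints and into
  every gap between consecutive right endpoints. Suppose \<open>2 (d + 1)\<^sup>2 < r\<close> and consider, in a
  \<open>d\<close>-sequence, the first contraction that identifies two points at distance at least \<open>r\<close> on one
  side, say the left. They are distinguished by \<open>r\<close> long intervals with consecutive left endpoints, so
  these intervals lie in at most \<open>d + 1\<close> classes and more than \<open>2 (d + 1)\<close> of them share a class. As
  their columns are distinct, the right endpoints in this class spread over about \<open>2 (d + 1) r\<close>
  right points, which in turn lie in at most \<open>d + 1\<close> classes. Undoing the contraction adds at most
  one class, so for \<open>d \<ge> 1\<close> two right points at distance at least \<open>r\<close> were identified even earlier.
  For \<open>d = 0\<close> already the first contraction fails, since the graph has no twins.\<close>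

section \<open>Contractions as maps on the original vertices\<close>

text \<open>Here \<open>f\<close> sends each original vertex to the part containing it. Only what
  black edges and non-edges guarantee is recorded: full or empty adjacency between two distinct
  parts. A red edge promises nothing.\<close>

definition quotient_map :: "'v rel \<Rightarrow> 'v set \<Rightarrow> 'a trigraph \<Rightarrow> ('v \<Rightarrow> 'a) \<Rightarrow> bool" where
  "quotient_map E V T f \<longleftrightarrow> f ` V \<subseteq> tverts T \<and>
    (\<forall>x\<in>V. \<forall>y\<in>V. f x \<noteq> f y \<longrightarrow>
      ((f x, f y) \<in> black T \<longrightarrow> (x, y) \<in> E) \<and>
      ((f x, f y) \<notin> black T \<union> red T \<longrightarrow> (x, y) \<notin> E))"

definition identify :: "'a \<Rightarrow> 'a \<Rightarrow> 'a \<Rightarrow> 'a \<Rightarrow> 'a" where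
  "identify u v w z = (if z = u \<or> z = v then w else z)"

lemma quotient_map_id: "quotient_map (parcs G) (pverts G) (trigraph_of G) id"
  by (simp add: quotient_map_def trigraph_of_def)

text \<open>The new vertex is joined in black, or not at all, only where both \<open>u\<close> and
  \<open>v\<close> were, so homogeneity passes to the merged part. As \<open>w\<close> avoids the
  surviving names, no other parts are merged.\<close>

lemma quotient_map_contract:
  assumes f: "quotient_map E V T f" and E: "sym E" and w: "w \<notin> tverts T - {u, v}"
  shows "quotient_map E V (contract u v w T) (identify u v w \<circ> f)"
proof -
  let ?T = "contract u v w T" and ?f = "identify u v w \<circ> f"
  have verts: "?f ` V \<subseteq> tverts ?T"
    using f by (auto simp: quotient_map_def contract_def Let_def identify_def)
  have tf: "f x \<in> tverts T" if "x \<in> V" for x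
    using f that by (auto simp: quotient_map_def)
  have bl: "(x, y) \<in> E" if "x \<in> V" "y \<in> V" "f x \<noteq> f y" "(f x, f y) \<in> black T" for x y
    using f that by (auto simp: quotient_map_def)
  have no: "(x, y) \<notin> E" if "x \<in> V" "y \<in> V" "f x \<noteq> f y" "(f x, f y) \<notin> black T \<union> red T" for x y
    using f that by (auto simp: quotient_map_def)
  have new: "((w, f y) \<in> black ?T \<longrightarrow> (x, y) \<in> E) \<and> ((w, f y) \<notin> black ?T \<union> red ?T \<longrightarrow> (x, y) \<notin> E)"
    and new': "((f y, w) \<in> black ?T \<longrightarrow> (x, y) \<in> E) \<and> ((f y, w) \<notin> black ?T \<union> red ?T \<longrightarrow> (x, y) \<notin> E)"
    if "x \<in> V" "y \<in> V" "f x \<in> {u, v}" "f y \<notin> {u, v}" for x y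
  proof -
    have "f y \<in> tverts T - {u, v}" "f y \<noteq> w" "f x \<noteq> f y"
      using tf[of y] that w by auto
    then show "((w, f y) \<in> black ?T \<longrightarrow> (x, y) \<in> E) \<and> ((w, f y) \<notin> black ?T \<union> red ?T \<longrightarrow> (x, y) \<notin> E)"
      and "((f y, w) \<in> black ?T \<longrightarrow> (x, y) \<in> E) \<and> ((f y, w) \<notin> black ?T \<union> red ?T \<longrightarrow> (x, y) \<notin> E)"
      using bl[of x y] no[of x y] that w by (auto simp: contract_def Let_def)
  qed
  have "((?f x, ?f y) \<in> black ?T \<longrightarrow> (x, y) \<in> E) \<and> ((?f x, ?f y) \<notin> black ?T \<union> red ?T \<longrightarrow> (x, y) \<notin> E)"
    if xy: "x \<in> V" "y \<in> V" "?f x \<noteq> ?f y" for x y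
  proof (cases "f x \<in> {u, v}")
    case True
    with xy have "f y \<notin> {u, v}"
      by (auto simp: identify_def)
    with new[of x y] True xy show ?thesis
      by (auto simp: identify_def)
  next
    case x: False
    show ?thesis
    proof (cases "f y \<in> {u, v}")
      case True
      with new'[of y x] x xy E show ?thesis
        by (auto simp: identify_def sym_def)
    next
      case False
      have "f x \<in> tverts T - {u, v}" "f y \<in> tverts T - {u, v}"
        using tf x False xy by auto
      then have "?f x = f x" "?f y = f y" "f x \<noteq> f y" "f x \<noteq> w" "f y \<noteq> w"
        using w xy x False by (auto simp: identify_def)
      with bl[of x y] no[of x y] x False xy tf[of x] tf[of y] show ?thesis
        by (auto simp: contract_def Let_def)
    qed
  qed
  with verts show ?thesis
    by (simp add: quotient_map_def)
qed

text \<open>Off \<open>u\<close> the identification is injective, so at most one class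
  disappears.\<close>

lemma card_image_identify:
  assumes "finite A" "A \<subseteq> X" "w \<notin> X - {u, v}"
  shows "card A \<le> Suc (card (identify u v w ` A))"
proof -
  have "inj_on (identify u v w) (A - {u})"
    using assms(2,3) by (auto simp: inj_on_def identify_def split: if_splits)
  then have "card (A - {u}) = card (identify u v w ` (A - {u}))"
    by (simp add: card_image)
  also have "\<dots> \<le> card (identify u v w ` A)"
    using assms(1) by (intro card_mono) auto
  finally show ?thesis
    using card_Diff1_le[of A u] assms(1) by (simp add: card_Diff_singleton_if split: if_splits)
qed

text \<open>If \<open>x\<close> and \<open>y\<close> disagree on \<open>z\<close>, then
  \<open>z\<close> lies in their common part or in a part joined to it by a red edge, and there are
  at most \<open>d\<close> of the latter. The first bound counts the common part even when
  \<open>S\<close> misses it.\<close>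

lemma card_image_separated:
  assumes f: "quotient_map E V T f" and wf: "wf_trigraph T"
    and deg: "\<forall>c\<in>tverts T. red_degree T c \<le> d"
    and xy: "x \<in> V" "y \<in> V" "f x = f y" and S: "S \<subseteq> V"
    and sep: "\<And>z. z \<in> S \<Longrightarrow> (x, z) \<in> E \<longleftrightarrow> (y, z) \<notin> E"
  shows "card (insert (f x) (f ` S)) \<le> Suc d" and "card (f ` S) \<le> Suc d"
proof -
  let ?R = "{c. (f x, c) \<in> red T}"
  have "?R \<subseteq> tverts T" "finite (tverts T)"
    using wf by (auto simp: wf_trigraph_iff)
  then have fin: "finite ?R"
    by (rule finite_subset)
  have sub: "f ` S \<subseteq> insert (f x) ?R"
  proof
    fix c assume "c \<in> f ` S"
    then obtain z where z: "z \<in> S" "c = f z" by auto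
    show "c \<in> insert (f x) ?R"
    proof (cases "f x = f z")
      case False
      show ?thesis
      proof -
        have "z \<in> V"
          using z S by auto
        with f xy False have "(f x, f z) \<in> black T \<longrightarrow> (x, z) \<in> E \<and> (y, z) \<in> E"
          "(f x, f z) \<notin> black T \<union> red T \<longrightarrow> (x, z) \<notin> E \<and> (y, z) \<notin> E"
          unfolding quotient_map_def by metis+
        with sep[OF z(1)] z(2) show ?thesis
          by auto
      qed
    qed (use z in simp)
  qed
  have "card (insert (f x) (f ` S)) \<le> card (insert (f x) ?R)"
    using sub fin by (intro card_mono) auto
  also have "\<dots> \<le> Suc (card ?R)"
    using fin by (simp add: card_insert_if)
  also have "card ?R \<le> d"
    using deg f xy by (auto simp: red_degree_def quotient_map_def)
  finally show *: "card (insert (f x) (f ` S)) \<le> Suc d" by simp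
  have "card (f ` S) \<le> card (insert (f x) (f ` S))"
    by (intro card_mono) (use sub fin finite_subset in auto)
  with * show "card (f ` S) \<le> Suc d" by simp
qed

section \<open>Transposing a square grid\<close>

text \<open>Cell \<open>p\<close>, counted row by row, has row \<open>p div r\<close> and column
  \<open>p mod r\<close>; the value is the number of the same cell counted column by column.\<close>

definition grid_flip :: "nat \<Rightarrow> nat \<Rightarrow> nat" where
  "grid_flip r p = p mod r * r + p div r"

lemma grid_flip_less:
  assumes "p < r * r"
  shows "grid_flip r p < r * r"
proof -
  have "p div r < r"
    using assms by (rule less_mult_imp_div_less)
  then have "Suc (p mod r) \<le> r"
    by (intro Suc_leI mod_less_divisor) simp
  then have "Suc (p mod r) * r \<le> r * r"
    by (rule mult_le_mono1)
  moreover have "grid_flip r p < Suc (p mod r) * r"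
    using \<open>p div r < r\<close> by (simp add: grid_flip_def)
  ultimately show ?thesis by simp
qed

lemma grid_flip_grid_flip: "p < r * r \<Longrightarrow> grid_flip r (grid_flip r p) = p"
  using less_mult_imp_div_less[of p r r] by (simp add: grid_flip_def)

lemma grid_flip_last: "grid_flip r (r * r - 1) = r * r - 1"
proof (cases r)
  case (Suc k)
  have "(k * Suc k + k) mod Suc k = k" "(k * Suc k + k) div Suc k = k"
    by (simp_all del: mult_Suc_right)
  moreover have "r * r - 1 = k * Suc k + k"
    by (simp add: Suc)
  ultimately show ?thesis
    by (simp add: grid_flip_def Suc del: mult_Suc_right)
qed (simp add: grid_flip_def)

text \<open>A window of \<open>r\<close> consecutive cells meets at most two rows, adjacent ones, so
  the row terms cost at most 1 while the columns contribute \<open>k * r\<close>.\<close>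

lemma grid_flip_gap:
  assumes p: "q < p" "p \<le> q + r" and p': "q < p'" "p' \<le> q + r"
    and k: "p mod r + k \<le> p' mod r"
  shows "grid_flip r p + k * r \<le> grid_flip r p' + 1"
proof -
  have "p div r \<le> p' div r + 1"
  proof -
    have "p < p' + r"
      using p p' by linarith
    then have "p div r \<le> (p' + r) div r"
      by (intro div_le_mono) simp
    then show ?thesis
      using p by (cases "r = 0") auto
  qed
  moreover have "(p mod r + k) * r \<le> p' mod r * r"
    using k by (rule mult_le_mono1)
  ultimately show ?thesis
    by (simp add: grid_flip_def algebra_simps)
qed

text \<open>Distinct numbers in the window differ by less than \<open>r\<close>. In the grid,
  \<open>r\<close> consecutive cells thus occupy distinct columns.\<close>

lemma inj_on_mod_interval: "inj_on (\<lambda>p. p mod r) {q<..q + r}" for q r :: nat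
proof (rule linorder_inj_onI')
  fix x y assume "x \<in> {q<..q + r}" "y \<in> {q<..q + r}" "x < y"
  then have "0 < y - x" "y - x < r" by auto
  then have "\<not> r dvd y - x"
    by (rule nat_dvd_not_less)
  then show "x mod r \<noteq> y mod r"
    using \<open>x < y\<close> by (metis less_imp_le mod_eq_dvd_iff_nat)
qed

section \<open>Pigeonhole principles for gaps and fibres\<close>

lemma exists_card_gap:
  fixes S :: "nat set"
  assumes "finite S" "k < card S"
  shows "\<exists>x\<in>S. \<exists>y\<in>S. x + k \<le> y"
proof -
  have ne: "S \<noteq> {}" using assms by auto
  have "S \<subseteq> {Min S..Max S}"
    using assms(1) by auto
  then have "card S \<le> card {Min S..Max S}"
    by (intro card_mono) auto
  then have "Min S + k \<le> Max S"
    using assms(2) by simp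
  then show ?thesis
    using assms(1) ne Min_in Max_in by blast
qed

lemma exists_large_fibre:
  assumes "finite A" "card (f ` A) \<le> m" "m * k < card A"
  shows "\<exists>c. k < card {x \<in> A. f x = c}"
proof (rule ccontr)
  assume "\<not> ?thesis"
  then have le: "card {x \<in> A. f x = c} \<le> k" for c
    by (simp add: not_less)
  have "card A = (\<Sum>c\<in>f ` A. card {x \<in> A. f x = c})"
    using sum.image_gen[OF assms(1), of "\<lambda>_. 1::nat" f] by simp
  also have "\<dots> \<le> card (f ` A) * k"
    using le by (intro sum_bounded_above[THEN order_trans]) auto
  also have "\<dots> \<le> m * k"
    using assms(2) by (rule mult_le_mono1)
  finally show False using assms(3) by simp
qed

section \<open>Identifying distant points\<close>

text \<open>Each side has \<open>r * r - 1\<close> points, one per gap between consecutive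
  endpoints. The distance \<open>r\<close> is the step between neighbouring columns in the
  column-by-column order.\<close>

definition far_merge :: "nat \<Rightarrow> (nat \<Rightarrow> 'v) \<Rightarrow> ('v \<Rightarrow> 'a) \<Rightarrow> bool" where
  "far_merge r l f \<longleftrightarrow> (\<exists>q q'. q + r \<le> q' \<and> q' < r * r - 1 \<and> f (l q) = f (l q'))"

text \<open>Stated for abstract sides: \<open>a\<close> lists the long intervals by their endpoints
  on the side of \<open>l\<close>, and \<open>grid_flip r\<close> gives their order on the side of
  \<open>m\<close>. This covers both passages, from left to right and back.\<close>

lemma far_merge_earlier:
  fixes a l m :: "nat \<Rightarrow> 'v"
  assumes f: "quotient_map E V T f" and w: "w \<notin> tverts T - {u, v}"
    and f': "quotient_map E V T' (identify u v w \<circ> f)"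
    and wf: "wf_trigraph T'"
    and deg: "\<forall>c\<in>tverts T'. red_degree T' c \<le> d"
    and d: "1 \<le> d" "2 * (d + 1) ^ 2 < r"
    and aV: "\<And>p. p < r * r \<Longrightarrow> a p \<in> V"
    and lV: "\<And>q. q < r * r - 1 \<Longrightarrow> l q \<in> V"
    and mV: "\<And>q. q < r * r - 1 \<Longrightarrow> m q \<in> V"
    and sep_l: "\<And>q p q'. q < p \<Longrightarrow> p \<le> q' \<Longrightarrow> q' < r * r - 1 \<Longrightarrow> (l q, a p) \<in> E \<longleftrightarrow> (l q', a p) \<notin> E"
    and sep_a: "\<And>p q p'. p < r * r \<Longrightarrow> p' < r * r \<Longrightarrow> grid_flip r p \<le> q \<Longrightarrow> q < grid_flip r p' \<Longrightarrow>
      (a p, m q) \<in> E \<longleftrightarrow> (a p', m q) \<notin> E"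
    and far: "far_merge r l (identify u v w \<circ> f)"
  shows "far_merge r m f"
proof -
  let ?g = "identify u v w \<circ> f"
  obtain q q' where q: "q + r \<le> q'" "q' < r * r - 1" "?g (l q) = ?g (l q')"
    using far by (auto simp: far_merge_def)
  \<comment> \<open>The endpoints numbered \<open>q + 1\<close> to \<open>q + r\<close> lie between
    the two merged points, so all these long intervals separate them.\<close>
  let ?P = "{q<..q + r}"
  have P: "p < r * r" if "p \<in> ?P" for p
    using that q by auto
  have "card (?g ` a ` ?P) \<le> Suc d"
  proof (rule card_image_separated(2)[OF f' wf deg])
    show "l q \<in> V" "l q' \<in> V" "a ` ?P \<subseteq> V"
      using q aV P lV by auto
    show "(l q, z) \<in> E \<longleftrightarrow> (l q', z) \<notin> E" if "z \<in> a ` ?P" for z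
      using that q sep_l[of q _ q'] by auto
  qed (rule q)
  then have "card ((?g \<circ> a) ` ?P) \<le> Suc d"
    by (simp add: image_comp)
  \<comment> \<open>The left side is \<open>2 * (d + 1) ^ 2\<close>, which explains the threshold on
    \<open>r\<close>.\<close>
  moreover have "Suc d * (2 * d + 2) < card ?P"
    using d by (simp add: power2_eq_square algebra_simps)
  ultimately obtain c where c: "2 * d + 2 < card {p \<in> ?P. (?g \<circ> a) p = c}"
    using exists_large_fibre[of ?P "?g \<circ> a" "Suc d" "2 * d + 2"] by auto
  let ?C = "{p \<in> ?P. (?g \<circ> a) p = c}"
  have "card ((\<lambda>p. p mod r) ` ?C) = card ?C"
    by (rule card_image) (rule inj_on_subset[OF inj_on_mod_interval[of r q]], auto)
  then obtain p p' where p: "p \<in> ?C" "p' \<in> ?C" "p mod r + (2 * d + 2) \<le> p' mod r"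
    using c exists_card_gap[of "(\<lambda>p. p mod r) ` ?C" "2 * d + 2"] by auto
  have gap: "grid_flip r p + (2 * d + 2) * r \<le> grid_flip r p' + 1"
    using p by (intro grid_flip_gap[of q]) auto
  have "p' mod r < r"
    using d(2) by simp
  then have r: "2 \<le> r"
    using p(3) by linarith
  \<comment> \<open>Sample positions at spacing \<open>r\<close>, starting from the endpoint of
    \<open>a p\<close>. The first \<open>2 * d + 2\<close> stay below that of \<open>a p'\<close>,
    as \<open>2 \<le> r\<close> absorbs the 1 lost in \<open>gap\<close>.\<close>
  define t where "t k = grid_flip r p + k * r" for k
  have t: "grid_flip r p \<le> t k" "t k < grid_flip r p'" "t k < r * r - 1" if "k < 2 * d + 2" for k
  proof -
    have "(k + 1) * r \<le> (2 * d + 2) * r"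
      using that by (intro mult_le_mono1) simp
    then show "t k < grid_flip r p'"
      using gap r by (simp add: t_def algebra_simps)
    moreover have "grid_flip r p' < r * r"
      using p P by (intro grid_flip_less) auto
    ultimately show "t k < r * r - 1" by simp
  qed (simp add: t_def)
  let ?M = "(m \<circ> t) ` {..<2 * d + 2}"
  have M: "?M \<subseteq> V"
    using t mV by auto
  have "card (?g ` ?M) \<le> Suc d"
  proof (rule card_image_separated(2)[OF f' wf deg])
    show "a p \<in> V" "a p' \<in> V" "?g (a p) = ?g (a p')"
      using p aV P by auto
    have "p < r * r" "p' < r * r"
      using p P by auto
    then show "(a p, z) \<in> E \<longleftrightarrow> (a p', z) \<notin> E" if "z \<in> ?M" for z
      using that t sep_a[of p p'] by auto
  qed (rule M)
  then have "card (identify u v w ` f ` ?M) \<le> Suc d"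
    by (simp add: image_comp comp_assoc)
  moreover have "card (f ` ?M) \<le> Suc (card (identify u v w ` f ` ?M))"
    using f M by (intro card_image_identify[OF _ _ w]) (auto simp: quotient_map_def)
  \<comment> \<open>Undoing the identification leaves at most \<open>d + 2\<close> classes, fewer
    than \<open>2 * d + 2\<close> because \<open>d\<close> is positive.\<close>
  ultimately have "card ((f \<circ> m \<circ> t) ` {..<2 * d + 2}) < card {..<2 * d + 2}"
    using d by (simp add: image_comp comp_assoc)
  then have "\<not> inj_on (f \<circ> m \<circ> t) {..<2 * d + 2}"
    by (rule pigeonhole)
  then obtain k k' where k: "k < k'" "k' < 2 * d + 2" "f (m (t k)) = f (m (t k'))"
    unfolding inj_on_def by (auto simp: linorder_neq_iff)
  have "(k + 1) * r \<le> k' * r"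
    using k by (intro mult_le_mono1) simp
  then have "t k + r \<le> t k'"
    by (simp add: t_def)
  then show ?thesis
    using k t(3)[OF k(2)] unfolding far_merge_def by blast
qed

section \<open>The interval graph\<close>

text \<open>The vertices below \<open>r * r\<close> are the long intervals, numbered by their left endpoints; the
  remaining ones are points in the gaps between consecutive left endpoints, and then points in the
  gaps between consecutive right endpoints.\<close>

definition grid_interval :: "nat \<Rightarrow> nat \<Rightarrow> real set" where
  "grid_interval r x =
    (if x < r * r then {real x .. real (r * r + grid_flip r x)}
     else if x < 2 * (r * r) - 1 then {real (x - r * r) + 1 / 2 .. real (x - r * r) + 1 / 2}
     else {real (x + 1 - r * r) + 1 / 2 .. real (x + 1 - r * r) + 1 / 2})"

definition grid_graph :: "nat \<Rightarrow> nat pair_pre_digraph" where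
  "grid_graph r = intersection_graph {..<3 * (r * r) - 2} (grid_interval r)"

lemma pverts_grid_graph [simp]: "pverts (grid_graph r) = {..<3 * (r * r) - 2}"
  by (simp add: grid_graph_def intersection_graph_def)

lemma interval_graph_grid_graph: "interval_graph (grid_graph r)"
  unfolding interval_graph_def
proof (intro conjI exI[of _ "grid_interval r"] ballI)
  fix x
  have "real x \<le> real (r * r + grid_flip r x)" if "x < r * r"
    using that by (simp del: of_nat_add of_nat_mult)
  then show "\<exists>a b. a \<le> b \<and> grid_interval r x = {a..b}"
    unfolding grid_interval_def by (cases "x < r * r"; cases "x < 2 * (r * r) - 1") force+
  show "grid_graph r = intersection_graph (pverts (grid_graph r)) (grid_interval r)"
    by (simp add: grid_graph_def intersection_graph_def)
qed simp

lemma sym_grid_graph: "sym (parcs (grid_graph r))"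
  by (auto simp: grid_graph_def intersection_graph_def sym_def)

definition left_point :: "nat \<Rightarrow> nat \<Rightarrow> nat" where
  "left_point r q = r * r + q"

definition right_point :: "nat \<Rightarrow> nat \<Rightarrow> nat" where
  "right_point r q = 2 * (r * r) - 1 + q"

lemma left_point_inject [simp]: "left_point r q = left_point r q' \<longleftrightarrow> q = q'"
  by (simp add: left_point_def)

lemma right_point_inject [simp]: "right_point r q = right_point r q' \<longleftrightarrow> q = q'"
  by (simp add: right_point_def)

lemma point_bounds:
  assumes "q < r * r - 1"
  shows "r * r \<le> left_point r q" "left_point r q < 2 * (r * r) - 1"
    and "2 * (r * r) - 1 \<le> right_point r q" "right_point r q < 3 * (r * r) - 2"
  using assms unfolding left_point_def right_point_def by linarith+

lemma grid_interval_points: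
  assumes "q < r * r - 1"
  shows "grid_interval r (left_point r q) = {real q + 1 / 2}"
    and "grid_interval r (right_point r q) = {real (r * r + q) + 1 / 2}"
proof -
  show "grid_interval r (left_point r q) = {real q + 1 / 2}"
    using point_bounds(1,2)[OF assms] by (simp add: grid_interval_def) (simp add: left_point_def)
  \<comment> \<open>There are only \<open>r * r - 1\<close> left points, so the names of the right
    points start one before \<open>2 * (r * r)\<close>; the \<open>+ 1\<close> in
    \<open>grid_interval\<close> corrects for this.\<close>
  have "right_point r q + 1 - r * r = r * r + q" "\<not> right_point r q < r * r"
    using assms unfolding right_point_def by linarith+
  then show "grid_interval r (right_point r q) = {real (r * r + q) + 1 / 2}"
    using point_bounds(3)[OF assms]
    unfolding grid_interval_def by (simp del: of_nat_add of_nat_mult)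
qed

text \<open>A left point lies before every right endpoint, these being at least
  \<open>r * r\<close>, so only the left endpoint decides.\<close>

lemma long_left_arc:
  assumes "p < r * r" "q < r * r - 1"
  shows "(p, left_point r q) \<in> parcs (grid_graph r) \<longleftrightarrow> p \<le> q"
    and "(left_point r q, p) \<in> parcs (grid_graph r) \<longleftrightarrow> p \<le> q"
proof -
  have "real q + 1 / 2 \<in> {real p .. real (r * r + grid_flip r p)} \<longleftrightarrow> p \<le> q"
    using assms by (auto simp del: of_nat_mult simp add: not_le)
  then show "(p, left_point r q) \<in> parcs (grid_graph r) \<longleftrightarrow> p \<le> q"
    "(left_point r q, p) \<in> parcs (grid_graph r) \<longleftrightarrow> p \<le> q"
    using assms grid_interval_points(1)[OF assms(2)] point_bounds[OF assms(2)]
    by (auto simp: grid_graph_def intersection_graph_def grid_interval_def)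
qed

text \<open>A right point lies beyond every left endpoint, so only the right endpoint
  decides.\<close>

lemma long_right_arc:
  assumes "p < r * r" "q < r * r - 1"
  shows "(p, right_point r q) \<in> parcs (grid_graph r) \<longleftrightarrow> q < grid_flip r p"
    and "(right_point r q, p) \<in> parcs (grid_graph r) \<longleftrightarrow> q < grid_flip r p"
proof -
  have "real (r * r + q) + 1 / 2 \<in> {real p .. real (r * r + grid_flip r p)} \<longleftrightarrow> q < grid_flip r p"
    using assms by (auto simp del: of_nat_mult simp add: not_le)
  then show "(p, right_point r q) \<in> parcs (grid_graph r) \<longleftrightarrow> q < grid_flip r p"
    "(right_point r q, p) \<in> parcs (grid_graph r) \<longleftrightarrow> q < grid_flip r p"
    using assms grid_interval_points(2)[OF assms(2)] point_bounds[OF assms(2)]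
    by (auto simp: grid_graph_def intersection_graph_def grid_interval_def)
qed

text \<open>The points sit at half-integers \<open>c z + 1 / 2\<close>, and these are distinct: the
  right points start at gap \<open>r * r\<close>, after the last left gap.\<close>

lemma point_point_no_arc:
  assumes "r * r \<le> x" "r * r \<le> y"
  shows "(x, y) \<notin> parcs (grid_graph r)"
proof -
  define c where "c z = (if z < 2 * (r * r) - 1 then z - r * r else z + 1 - r * r)" for z
  have "grid_interval r z = {real (c z) + 1 / 2}" if "r * r \<le> z" for z
    using that by (simp add: grid_interval_def c_def)
  moreover have "c x \<noteq> c y" if "x \<noteq> y"
    using that assms unfolding c_def by (simp split: if_splits) linarith+
  ultimately show ?thesis
    using assms by (auto simp: grid_graph_def intersection_graph_def)
qed

lemma pverts_grid_graph_cases: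
  assumes "x < 3 * (r * r) - 2"
  obtains "x < r * r"
    | q where "q < r * r - 1" "x = left_point r q"
    | q where "q < r * r - 1" "x = right_point r q"
proof (cases "x < r * r")
  case False
  show ?thesis
  proof (cases "x < 2 * (r * r) - 1")
    case True
    then show ?thesis
      using False that(2)[of "x - r * r"] unfolding left_point_def by linarith
  next
    case False
    then show ?thesis
      using assms that(3)[of "x - (2 * (r * r) - 1)"] unfolding right_point_def by linarith
  qed
qed (rule that(1))

section \<open>Absence of twins\<close>

text \<open>This rules out width 0 at the very first contraction. As \<open>u < v\<close> and the
  numbering runs through long intervals, left points and right points, six pairs of types
  remain.\<close>

lemma grid_graph_no_twins:
  assumes r: "2 \<le> r" and uv: "u < v" "v < 3 * (r * r) - 2"
  shows "\<exists>x < 3 * (r * r) - 2. x \<noteq> u \<and> x \<noteq> v \<and>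
    ((u, x) \<in> parcs (grid_graph r) \<longleftrightarrow> (v, x) \<notin> parcs (grid_graph r))"
proof -
  let ?N = "r * r"
  have "2 * 2 \<le> ?N"
    using r by (intro mult_le_mono) auto
  then have N: "4 \<le> ?N" by simp
  have "0 < r"
    using r by simp
  have last: "grid_flip r (?N - 1) = ?N - 1"
    by (rule grid_flip_last)
  have first: "p = 0" if "grid_flip r p = 0" "p < ?N" for p
  proof -
    have "p = grid_flip r 0"
      using grid_flip_grid_flip[OF that(2)] unfolding that(1) by (rule sym)
    then show ?thesis
      by (simp add: grid_flip_def)
  qed
  let ?E = "parcs (grid_graph r)"
  have witness: ?thesis
    if "x < 3 * ?N - 2" "x \<noteq> u" "x \<noteq> v" "(u, x) \<in> ?E \<longleftrightarrow> P" "(v, x) \<in> ?E \<longleftrightarrow> \<not> P" for x P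
    using that by blast
  show ?thesis
  proof (cases rule: pverts_grid_graph_cases[OF uv(2)])
    case 1
    with uv have u: "u < ?N" "u < ?N - 1" by linarith+
    \<comment> \<open>The gap right after the left endpoint of \<open>u\<close> is covered by
      \<open>u\<close> but not by \<open>v\<close>.\<close>
    show ?thesis
    proof (rule witness[of "left_point r u" True])
      show "left_point r u < 3 * ?N - 2" "left_point r u \<noteq> u" "left_point r u \<noteq> v"
        using point_bounds[OF u(2)] u 1 by linarith+
    qed (use uv 1 u in \<open>simp_all add: long_left_arc\<close>)
  next
    case v: (2 q)
    note qb = point_bounds[OF v(1)]
    show ?thesis
    proof (cases "u < ?N")
      case u: True
      \<comment> \<open>The first right point is met by \<open>u\<close> unless \<open>u\<close> has
        the smallest right endpoint; then \<open>u\<close> is 0 and meets every left point.\<close>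
      show ?thesis
      proof (cases "grid_flip r u = 0")
        case True
        with first u have u0: "u = 0" by simp
        define q' where "q' = (if q = 0 then 1 else 0 :: nat)"
        have q': "q' < ?N - 1" "q' \<noteq> q"
          using N by (auto simp: q'_def)
        show ?thesis
        proof (rule witness[of "left_point r q'" True])
          show "left_point r q' < 3 * ?N - 2" "left_point r q' \<noteq> u"
            using point_bounds[OF q'(1)] u by linarith+
          have "(v, left_point r q') \<notin> ?E"
            by (rule point_point_no_arc) (use v(2) qb point_bounds[OF q'(1)] N in linarith)+
          then show "(v, left_point r q') \<in> ?E \<longleftrightarrow> \<not> True"
            by simp
        qed (use v q' u u0 in \<open>simp_all add: long_left_arc\<close>)
      next
        case False
        have z: "0 < ?N - 1"
          using N by linarith
        show ?thesis
        proof (rule witness[of "right_point r 0" True])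
          show "right_point r 0 < 3 * ?N - 2" "right_point r 0 \<noteq> u" "right_point r 0 \<noteq> v"
            using point_bounds[OF z] qb u v N by linarith+
          have "(v, right_point r 0) \<notin> ?E"
            by (rule point_point_no_arc) (use v(2) qb point_bounds[OF z] N in linarith)+
          then show "(v, right_point r 0) \<in> ?E \<longleftrightarrow> \<not> True"
            by simp
        qed (use u False z in \<open>simp add: long_right_arc(1)[OF u z]\<close>)
      qed
    next
      case False
      define p where "p = u - ?N"
      have p: "u = left_point r p" "p < q" "p < ?N - 1"
        using False uv v unfolding p_def left_point_def by linarith+
      have sp: "Suc p < ?N"
        using p by linarith
      show ?thesis
      proof (rule witness[of "Suc p" False])
        show "Suc p < 3 * ?N - 2" "Suc p \<noteq> u" "Suc p \<noteq> v"
          using sp N p(1) v(2) point_bounds[OF p(3)] qb by linarith+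
        show "(u, Suc p) \<in> ?E \<longleftrightarrow> False" "(v, Suc p) \<in> ?E \<longleftrightarrow> \<not> False"
          using p long_left_arc(2)[OF sp p(3)] long_left_arc(2)[OF sp v(1)] v(2) by simp_all
      qed
    qed
  next
    case v: (3 q)
    note qb = point_bounds[OF v(1)]
    have "u < 3 * ?N - 2"
      using uv by simp
    then show ?thesis
    proof (cases rule: pverts_grid_graph_cases)
      case u: 1
      \<comment> \<open>The interval with the last left endpoint meets all right points; any other
        long interval meets the last left point.\<close>
      show ?thesis
      proof (cases "u = ?N - 1")
        case True
        define q' where "q' = (if q = 0 then 1 else 0 :: nat)"
        have q': "q' < ?N - 1" "q' \<noteq> q"
          using N by (auto simp: q'_def)
        show ?thesis
        proof (rule witness[of "right_point r q'" True])
          show "right_point r q' < 3 * ?N - 2" "right_point r q' \<noteq> u"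
            using point_bounds[OF q'(1)] u N by linarith+
          have "(v, right_point r q') \<notin> ?E"
            by (rule point_point_no_arc) (use v(2) qb point_bounds[OF q'(1)] N in linarith)+
          then show "(v, right_point r q') \<in> ?E \<longleftrightarrow> \<not> True"
            by simp
          show "(u, right_point r q') \<in> ?E \<longleftrightarrow> True"
            using long_right_arc(1)[OF u q'(1)] last q'(1) by (simp only: True)
        qed (use v q' in simp)
      next
        case False
        have z: "?N - 2 < ?N - 1" "u \<le> ?N - 2"
          using N u False by linarith+
        show ?thesis
        proof (rule witness[of "left_point r (?N - 2)" True])
          show "left_point r (?N - 2) < 3 * ?N - 2" "left_point r (?N - 2) \<noteq> u"
            "left_point r (?N - 2) \<noteq> v"
            using point_bounds[OF z(1)] qb u v N by linarith+
          have "(v, left_point r (?N - 2)) \<notin> ?E"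
            by (rule point_point_no_arc) (use v(2) qb point_bounds[OF z(1)] N in linarith)+
          then show "(v, left_point r (?N - 2)) \<in> ?E \<longleftrightarrow> \<not> True"
            by simp
          show "(u, left_point r (?N - 2)) \<in> ?E \<longleftrightarrow> True"
            using long_left_arc(1)[OF u z(1)] z(2) by blast
        qed
      qed
    next
      case u: (2 p)
      have z: "?N - 1 < ?N"
        using N by linarith
      \<comment> \<open>The interval \<open>?N - 1\<close> misses every left point and meets every
        right point.\<close>
      show ?thesis
      proof (rule witness[of "?N - 1" False])
        show "?N - 1 < 3 * ?N - 2" "?N - 1 \<noteq> u" "?N - 1 \<noteq> v"
          using N u(2) v(2) point_bounds[OF u(1)] qb by linarith+
        show "(u, ?N - 1) \<in> ?E \<longleftrightarrow> False"
          using long_left_arc(2)[OF z u(1)] u(1)[folded not_le] unfolding u(2) by blast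
        show "(v, ?N - 1) \<in> ?E \<longleftrightarrow> \<not> False"
          using long_right_arc(2)[OF z v(1)] v(1) unfolding v(2) last by blast
      qed
    next
      case u: (3 p)
      have p: "p < q" "Suc p < ?N"
        using u v uv(1) unfolding right_point_def by linarith+
      \<comment> \<open>The long interval whose right endpoint has rank \<open>Suc p\<close> ends
        between the two right points.\<close>
      let ?x = "grid_flip r (Suc p)"
      have x: "grid_flip r ?x = Suc p" "?x < ?N"
        using p by (simp_all add: grid_flip_grid_flip grid_flip_less)
      show ?thesis
      proof (rule witness[of ?x True])
        show "?x < 3 * ?N - 2" "?x \<noteq> u" "?x \<noteq> v"
          using x N u(2) v(2) point_bounds[OF u(1)] qb by linarith+
        show "(u, ?x) \<in> ?E \<longleftrightarrow> True" "(v, ?x) \<in> ?E \<longleftrightarrow> \<not> True"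
          using long_right_arc(2)[OF x(2) u(1)] long_right_arc(2)[OF x(2) v(1)] x(1) u(2) v(2) p(1)
          by simp_all
      qed
    qed
  qed
qed

section \<open>The lower bound on the twin-width\<close>

text \<open>If \<open>2 * (d + 1) ^ 2 < r\<close>, no stage could merge far points on either side,
  yet the final single vertex merges all of them.\<close>

lemma d_sequence_grid_graph:
  assumes H: "d_sequence d (grid_graph r) H" and r: "3 \<le> r"
  shows "r \<le> 2 * (d + 1) ^ 2"
proof (rule ccontr)
  assume "\<not> ?thesis"
  then have d: "2 * (d + 1) ^ 2 < r" by simp
  let ?G = "grid_graph r" and ?N = "r * r"
  let ?n = "3 * ?N - 2"
  let ?E = "parcs ?G" and ?V = "pverts ?G"
  have "3 * r \<le> ?N"
    using r by (rule mult_le_mono1)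
  with r have N: "3 * r \<le> ?N" "9 \<le> ?N"
    by linarith+
  have pg: "pair_graph ?G"
    by (rule interval_graph_imp_pair_graph[OF interval_graph_grid_graph])
  have Hn: "H ?n = trigraph_of ?G"
    and step: "\<And>s. 1 \<le> s \<Longrightarrow> s < ?n \<Longrightarrow> contraction (H (Suc s)) (H s)"
    and H1: "\<exists>x. tverts (H 1) = {x}"
    and deg: "\<And>s. 1 \<le> s \<Longrightarrow> s \<le> ?n \<Longrightarrow> \<forall>x\<in>tverts (H s). red_degree (H s) x \<le> d"
    using H by (auto simp: d_sequence_def contraction_sequence_def)
  have d1: "1 \<le> d"
  proof (rule ccontr)
    assume "\<not> 1 \<le> d"
    have n: "1 \<le> ?n - 1" "?n - 1 < ?n" "Suc (?n - 1) = ?n"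
      using N by linarith+
    then have c: "contraction (trigraph_of ?G) (H (?n - 1))"
      using step[of "?n - 1"] Hn by simp
    then obtain u v w where uvw: "u \<in> ?V" "v \<in> ?V" "u \<noteq> v" "w \<notin> ?V - {u, v}"
      and eq: "H (?n - 1) = contract u v w (trigraph_of ?G)"
      by (auto simp: contraction_def trigraph_of_def)
    let ?f = "identify u v w \<circ> id"
    have f: "quotient_map ?E ?V (H (?n - 1)) ?f"
      unfolding eq using uvw
      by (intro quotient_map_contract quotient_map_id sym_grid_graph) (simp add: trigraph_of_def)
    obtain x where x: "x \<in> ?V" "x \<noteq> u" "x \<noteq> v" "(u, x) \<in> ?E \<longleftrightarrow> (v, x) \<notin> ?E"
      using grid_graph_no_twins[of r u v] grid_graph_no_twins[of r v u] uvw r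
      by (cases u v rule: linorder_cases) auto
    \<comment> \<open>Width 0 allows only one part here, but the merged vertex and \<open>x\<close>
      give two.\<close>
    have "card (insert (?f u) (?f ` {x})) \<le> Suc d"
      using uvw x n
      by (intro card_image_separated(1)[OF f wf_contraction(1)[OF wf_trigraph_of[OF pg] c] deg, of u v])
        (auto simp: identify_def)
    moreover have "?f u \<noteq> ?f x"
      using uvw x by (auto simp: identify_def)
    ultimately show False
      using \<open>\<not> 1 \<le> d\<close> by simp
  qed
  \<comment> \<open>The invariant after \<open>k\<close> contractions excludes far merges on both
    sides at once, because a far merge on one side is traced to an earlier one on the other.\<close>
  have "\<exists>f. wf_trigraph (H (?n - k)) \<and> quotient_map ?E ?V (H (?n - k)) f \<and>
      \<not> far_merge r (left_point r) f \<and> \<not> far_merge r (right_point r) f" if "k < ?n" for k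
    using that
  proof (induction k)
    case 0
    have "\<not> far_merge r (left_point r) id" "\<not> far_merge r (right_point r) id"
      using r by (auto simp: far_merge_def)
    then show ?case
      using wf_trigraph_of[OF pg] quotient_map_id[of ?G] by (metis Hn diff_zero)
  next
    case (Suc k)
    let ?s = "?n - Suc k"
    have s: "1 \<le> ?s" "?s < ?n" "?s \<le> ?n" "Suc ?s = ?n - k"
      using Suc.prems by linarith+
    then have c: "contraction (H (?n - k)) (H ?s)"
      using step[of ?s] by simp
    obtain f where wf: "wf_trigraph (H (?n - k))" and f: "quotient_map ?E ?V (H (?n - k)) f"
      and near: "\<not> far_merge r (left_point r) f" "\<not> far_merge r (right_point r) f"
      using Suc by auto
    obtain u v w where w: "w \<notin> tverts (H (?n - k)) - {u, v}"
      and eq: "H ?s = contract u v w (H (?n - k))"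
      using c by (auto simp: contraction_def)
    let ?g = "identify u v w \<circ> f"
    have g: "quotient_map ?E ?V (H ?s) ?g"
      unfolding eq by (rule quotient_map_contract[OF f sym_grid_graph w])
    have wf': "wf_trigraph (H ?s)"
      by (rule wf_contraction(1)[OF wf c])
    note earlier = far_merge_earlier[OF f w g wf' deg[OF s(1,3)] d1 d]
    have bound: "q < ?N - 1" if "q < grid_flip r p" "p < ?N" for p q
      using that grid_flip_less[of p r] by linarith
    have verts: "p < ?N \<Longrightarrow> p \<in> ?V" "q < ?N - 1 \<Longrightarrow> left_point r q \<in> ?V"
      "q < ?N - 1 \<Longrightarrow> right_point r q \<in> ?V" for p q
      using point_bounds[of q r] N unfolding pverts_grid_graph lessThan_iff by linarith+
    have "\<not> far_merge r (left_point r) ?g"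
    proof
      assume "far_merge r (left_point r) ?g"
      have "far_merge r (right_point r) f"
      proof (rule earlier)
        show "far_merge r (left_point r) ?g" by fact
        show "(left_point r q, p) \<in> ?E \<longleftrightarrow> (left_point r q', p) \<notin> ?E"
          if "q < p" "p \<le> q'" "q' < ?N - 1" for q p q'
          using that long_left_arc(2)[of p r q] long_left_arc(2)[of p r q'] by linarith
        show "(p, right_point r q) \<in> ?E \<longleftrightarrow> (p', right_point r q) \<notin> ?E"
          if "p < ?N" "p' < ?N" "grid_flip r p \<le> q" "q < grid_flip r p'" for p q p'
          using that long_right_arc(1)[OF that(1) bound] long_right_arc(1)[OF that(2) bound] by auto
      qed (use verts in blast)+
      with near show False by simp
    qed
    moreover have "\<not> far_merge r (right_point r) ?g"
    proof
      assume "far_merge r (right_point r) ?g"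
      \<comment> \<open>Now \<open>a\<close> is \<open>grid_flip r\<close>: as this is an involution
        on the grid, the interval \<open>grid_flip r p\<close> has right endpoint rank
        \<open>p\<close>.\<close>
      have "far_merge r (left_point r) f"
      proof (rule earlier)
        show "far_merge r (right_point r) ?g" by fact
        show "(right_point r q, grid_flip r p) \<in> ?E \<longleftrightarrow> (right_point r q', grid_flip r p) \<notin> ?E"
          if "q < p" "p \<le> q'" "q' < ?N - 1" for q p q'
        proof -
          have "p < ?N" "q < ?N - 1"
            using that by linarith+
          then show ?thesis
            using that long_right_arc(2)[of "grid_flip r p" r] grid_flip_less grid_flip_grid_flip
            by simp
        qed
        show "(grid_flip r p, left_point r q) \<in> ?E \<longleftrightarrow> (grid_flip r p', left_point r q) \<notin> ?E"
          if "p < ?N" "p' < ?N" "grid_flip r p \<le> q" "q < grid_flip r p'" for p q p'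
          using that long_left_arc(1)[OF grid_flip_less[OF that(1)] bound[OF that(4,2)]]
            long_left_arc(1)[OF grid_flip_less[OF that(2)] bound[OF that(4,2)]] by auto
        show "grid_flip r p \<in> ?V" if "p < ?N" for p
          by (rule verts(1)[OF grid_flip_less[OF that]])
      qed (use verts in blast)+
      with near show False by simp
    qed
    ultimately show ?case
      using g wf' by blast
  qed
  moreover have "?n - 1 < ?n" "?n - (?n - 1) = 1"
    using N by linarith+
  ultimately obtain f where f: "quotient_map ?E ?V (H 1) f"
    and near: "\<not> far_merge r (left_point r) f"
    by metis
  \<comment> \<open>The left points 0 and \<open>r\<close> exist, are at distance \<open>r\<close>,
    and coincide in the one-vertex trigraph.\<close>
  have r': "r < ?N - 1" "0 < ?N - 1"
    using N r by linarith+
  then have "left_point r 0 \<in> ?V" "left_point r r \<in> ?V"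
    using point_bounds[OF r'(1)] point_bounds[OF r'(2)] N
    unfolding pverts_grid_graph lessThan_iff by linarith+
  moreover obtain x where "f ` ?V \<subseteq> {x}"
    using f H1 unfolding quotient_map_def by metis
  ultimately have "f (left_point r 0) = f (left_point r r)"
    by blast
  then have "far_merge r (left_point r) f"
    unfolding far_merge_def using r' by (intro exI[of _ 0] exI[of _ r]) simp
  with near show False by simp
qed

theorem theorem5p2:
  fixes r n :: nat
  assumes "r \<ge> 2" and "n = 3 * r ^ 2 - 2"
  shows "\<exists>G :: nat pair_pre_digraph. interval_graph G \<and> card (pverts G) = n \<and>
           real (tww G) \<ge> ((real n + 2) / 12) powr (1 / 4) - 1"
proof (intro exI[of _ "grid_graph r"] conjI)
  let ?d = "tww (grid_graph r)"
  show "interval_graph (grid_graph r)"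
    by (rule interval_graph_grid_graph)
  show "card (pverts (grid_graph r)) = n"
    using assms by (simp add: power2_eq_square)
  have "1 * 1 \<le> r * r"
    using assms by (intro mult_le_mono) auto
  then have pos: "0 < 3 * (r * r) - 2" by linarith
  then have "pverts (grid_graph r) \<noteq> {}"
    unfolding pverts_grid_graph by blast
  then obtain H where H: "d_sequence ?d (grid_graph r) H"
    using tww_attained[OF interval_graph_imp_pair_graph[OF interval_graph_grid_graph]] by blast
  \<comment> \<open>The case \<open>r = 2\<close> is immediate, as the right side is at least
    2.\<close>
  have "r \<le> 2 * (?d + 1) ^ 2"
  proof (cases "r = 2")
    case False
    with assms show ?thesis
      by (intro d_sequence_grid_graph[OF H]) simp
  qed simp
  then have "real r \<le> real (2 * (?d + 1) ^ 2)"
    by (rule of_nat_mono)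
  then have "real r / 2 \<le> (real ?d + 1) ^ 2"
    by (simp add: add.commute)
  \<comment> \<open>Squaring leads to the claimed form, since \<open>(n + 2) / 12\<close> equals
    \<open>(r / 2) ^ 2\<close> and the fourth root of the right side is
    \<open>?d + 1\<close>.\<close>
  then have "(real r / 2) ^ 2 \<le> ((real ?d + 1) ^ 2) ^ 2"
    by (intro power_mono) auto
  moreover have "real n + 2 = 3 * real r ^ 2"
    using assms pos by (simp add: of_nat_diff power2_eq_square)
  ultimately have "(real n + 2) / 12 \<le> (real ?d + 1) ^ 4"
    by (simp add: power_divide flip: power_mult)
  then have "((real n + 2) / 12) powr (1 / 4) \<le> ((real ?d + 1) ^ 4) powr (1 / 4)"
    by (intro powr_mono2) auto
  also have "(real ?d + 1) ^ 4 = (real ?d + 1) powr 4"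
    by simp
  also have "\<dots> powr (1 / 4) = real ?d + 1"
    unfolding powr_powr by simp
  finally show "real ?d \<ge> ((real n + 2) / 12) powr (1 / 4) - 1"
    by simp
qed

end
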